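(* Let $\mathcal{L}_n=\{(x_0,x_1)\in\mathbb{R}\times\mathbb{R}^n:x_0\ge\|x_1\|\}$ be the Lorentz cone with barrier $F(x)=-\ln(x_0^2-\|x_1\|^2)$, and let $x=(x_0,x_1)\in\operatorname{int}\mathcal{L}_n$ and $s=(s_0,s_1)\in\operatorname{int}\mathcal{L}_n$. Put $\omega_x=x_0^2-\|x_1\|^2$, $\omega_s=s_0^2-\|s_1\|^2$, $\langle s,x\rangle=s_0x_0+\langle s_1,x_1\rangle$, $$\alpha_*=\frac{\langle s,x\rangle}{\langle s,x\rangle+[\omega_x\omega_s]^{1/2}},\qquad \beta_*=\frac{\langle s,x\rangle}{\omega_s}(1-\alpha_* ),$$ $$f(\alpha_* )=\frac{\langle s,x\rangle^2(1-\alpha_* )+\alpha_*\omega_x\omega_s}{\langle s,x\rangle^2(1-\alpha_*^2)+\alpha_*^2\omega_x\omega_s},\qquad \tau_*=\sqrt{\frac{2}{\langle s,x\rangle}f(\alpha_* )} .$$ Then the unique scaling point $w^*\in\operatorname{int}\mathcal{L}_n$ with $s=\nabla^2F(w^* )x$ is $w^*=(w_0^*,w_1^* )$, where $$w_0^*=\tau_*(\alpha_*x_0+\beta_*s_0),\qquad w_1^*=\tau_*(\alpha_*x_1-\beta_*s_1).$$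
   Context: $\|\cdot\|$ and $\langle\cdot,\cdot\rangle$ are the Euclidean norm and inner product; the dual space of $\mathbb{R}\times\mathbb{R}^n$ is identified with itself by the standard inner product, so $\mathcal{L}_n^*=\mathcal{L}_n$ and $\nabla^2F(w)$ is the usual Hessian matrix of $F$ at $w$. *)

theory Defs
  imports "HOL-Analysis.Analysis"
begin

definition lorentz_cone :: "(real \<times> (real ^ 'n)) set" where
  "lorentz_cone = {(x0, x1). x0 \<ge> norm x1}"

definition lorentz_omega :: "real \<times> (real ^ 'n) \<Rightarrow> real" where
  "lorentz_omega x = (fst x)\<^sup>2 - (norm (snd x))\<^sup>2"

definition lorentz_barrier :: "real \<times> (real ^ 'n) \<Rightarrow> real" where
  "lorentz_barrier x = - ln (lorentz_omega x)"

definition gradient :: "('a::real_inner \<Rightarrow> real) \<Rightarrow> 'a \<Rightarrow> 'a" where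
  "gradient F x = (THE g. GDERIV F x :> g)"

text \<open>The Hessian, as a linear operator acting on vectors, is the Jacobian of the gradient map.
  Like \<^const>\<open>frechet_derivative\<close>, it is meaningful only where the derivatives exist.\<close>

definition hessian :: "('a::real_inner \<Rightarrow> real) \<Rightarrow> 'a \<Rightarrow> 'a \<Rightarrow> 'a" where
  "hessian F w = frechet_derivative (gradient F) (at w)"

lemma gradient_eqI:
  assumes "GDERIV F x :> g"
  shows "gradient F x = g"
  unfolding gradient_def
proof (rule the_equality)
  fix h assume "GDERIV F x :> h"
  then have "(\<lambda>v. inner v h) = (\<lambda>v. inner v g)"
    using assms unfolding gderiv_def by (rule has_derivative_unique)
  then show "h = g"
    by (metis vector_eq_ldot)
qed (fact assms)

lemma hessian_eqI:
  assumes "open U" "w \<in> U" "\<And>y. y \<in> U \<Longrightarrow> GDERIV F y :> g y" "(g has_derivative H) (at w)"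
  shows "hessian F w = H"
proof -
  have "(gradient F has_derivative H) (at w)"
    using has_derivative_transform_within_open[OF assms(4,1,2)] assms(3) gradient_eqI by metis
  then show ?thesis
    unfolding hessian_def by (metis frechet_derivative_at)
qed

definition is_scaling_point ::
    "real \<times> (real ^ 'n) \<Rightarrow> real \<times> (real ^ 'n) \<Rightarrow> real \<times> (real ^ 'n) \<Rightarrow> bool" where
  "is_scaling_point s x w \<longleftrightarrow> w \<in> interior lorentz_cone \<and> s = hessian lorentz_barrier w x"

end

theory Submission
  imports Defs
begin

text \<open>Let \<open>J (a, b) = (a, - b)\<close>, let \<open>B v w = \<langle>J v, w\<rangle>\<close> be the Lorentz form, so \<open>\<omega>\<^sub>v = B v v\<close>, and put
  \<open>p = J s\<close>. The scaling equation \<open>s = \<nabla>\<^sup>2F(w) x\<close> reads \<open>p = (4 B w x / \<omega>\<^sub>w\<^sup>2) w - (2 / \<omega>\<^sub>w) x\<close>, so \<open>w\<close> is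
  a positive multiple of \<open>x + (\<omega>\<^sub>w / 2) p\<close>. Evaluating \<open>B p p\<close> and \<open>B p x\<close> gives
  \<open>\<omega>\<^sub>p = 4 \<omega>\<^sub>x / \<omega>\<^sub>w\<^sup>2\<close> and \<open>B p x + (\<omega>\<^sub>x \<omega>\<^sub>p)\<^sup>1\<^sup>/\<^sup>2 = (2 B w x / \<omega>\<^sub>w)\<^sup>2\<close>, which determines both \<open>\<omega>\<^sub>w\<close> and the
  multiple; conversely the resulting point solves the equation. The closed form with \<open>\<alpha>\<^sub>*\<close>, \<open>\<beta>\<^sub>*\<close>,
  \<open>\<tau>\<^sub>*\<close> simplifies to this point.\<close>

definition lorentz_reflect :: "real \<times> (real ^ 'n) \<Rightarrow> real \<times> (real ^ 'n)" where
  "lorentz_reflect v = (fst v, - snd v)"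

definition lorentz_form :: "real \<times> (real ^ 'n) \<Rightarrow> real \<times> (real ^ 'n) \<Rightarrow> real" where
  "lorentz_form v w = fst v * fst w - inner (snd v) (snd w)"

lemma lorentz_omega_form: "lorentz_omega v = lorentz_form v v"
  by (simp add: lorentz_omega_def lorentz_form_def power2_eq_square flip: power2_norm_eq_inner)

lemma lorentz_form_commute: "lorentz_form v w = lorentz_form w v"
  by (simp add: lorentz_form_def inner_commute mult.commute)

lemma lorentz_form_algebra:
  "lorentz_form (u + v) w = lorentz_form u w + lorentz_form v w"
  "lorentz_form w (u + v) = lorentz_form w u + lorentz_form w v"
  "lorentz_form (u - v) w = lorentz_form u w - lorentz_form v w"
  "lorentz_form w (u - v) = lorentz_form w u - lorentz_form w v"
  "lorentz_form (k *\<^sub>R v) w = k * lorentz_form v w"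
  "lorentz_form w (k *\<^sub>R v) = k * lorentz_form w v"
  by (simp_all add: lorentz_form_def inner_simps algebra_simps)

lemma inner_eq_lorentz_form: "inner v w = lorentz_form (lorentz_reflect v) w"
  by (cases v; cases w) (simp add: lorentz_form_def lorentz_reflect_def)

lemma lorentz_reflect_reflect [simp]: "lorentz_reflect (lorentz_reflect v) = v"
  by (simp add: lorentz_reflect_def)

lemma lorentz_omega_reflect [simp]: "lorentz_omega (lorentz_reflect v) = lorentz_omega v"
  by (simp add: lorentz_reflect_def lorentz_omega_def)

lemma bounded_linear_lorentz_reflect: "bounded_linear lorentz_reflect"
  unfolding lorentz_reflect_def
  by (intro bounded_linear_Pair bounded_linear_fst bounded_linear_minus bounded_linear_snd)

lemma interior_lorentz_cone:
  "interior lorentz_cone = {v :: real \<times> (real ^ 'n). norm (snd v) < fst v}"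
proof (rule interior_unique)
  show "{v :: real \<times> (real ^ 'n). norm (snd v) < fst v} \<subseteq> lorentz_cone"
    by (auto simp: lorentz_cone_def)
  show "open {v :: real \<times> (real ^ 'n). norm (snd v) < fst v}"
    by (intro open_Collect_less continuous_intros)
next
  fix T :: "(real \<times> (real ^ 'n)) set"
  assume T: "T \<subseteq> lorentz_cone" "open T"
  show "T \<subseteq> {v. norm (snd v) < fst v}"
  proof
    fix v assume "v \<in> T"
    then obtain e where e: "e > 0" "cball v e \<subseteq> T"
      using T(2) open_contains_cball by blast
    \<comment> \<open>Lowering only the first coordinate by the full radius stays in the closed
      ball; cone membership of this point leaves a gap of e, which gives strictness at
      \<open>v\<close>.\<close>
    have "(fst v - e, snd v) \<in> cball v e"
      using e(1) by (cases v) (simp add: dist_Pair_Pair dist_real_def)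
    then have "norm (snd v) \<le> fst v - e"
      using e T(1) by (auto simp: lorentz_cone_def)
    then show "v \<in> {v. norm (snd v) < fst v}"
      using e(1) by simp
  qed
qed

text \<open>Cauchy-Schwarz, followed by multiplying the two strict bounds norm < first coordinate.
  Applied to J s and x it also gives \<open>inner s x > 0\<close>.\<close>

lemma lorentz_form_pos:
  assumes "v \<in> interior lorentz_cone" "w \<in> interior lorentz_cone"
  shows "0 < lorentz_form v w"
proof -
  have "inner (snd v) (snd w) \<le> norm (snd v) * norm (snd w)"
    by (rule norm_cauchy_schwarz)
  also have "\<dots> < fst v * fst w"
    using assms by (intro mult_strict_mono') (auto simp: interior_lorentz_cone)
  finally show ?thesis
    by (simp add: lorentz_form_def)
qed

lemma lorentz_omega_pos: "v \<in> interior lorentz_cone \<Longrightarrow> 0 < lorentz_omega v"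
  by (simp add: lorentz_omega_form lorentz_form_pos)

lemma lorentz_reflect_interior:
  "v \<in> interior lorentz_cone \<Longrightarrow> lorentz_reflect v \<in> interior lorentz_cone"
  by (simp add: interior_lorentz_cone lorentz_reflect_def)

lemma interior_lorentz_cone_add:
  assumes "v \<in> interior lorentz_cone" "w \<in> interior lorentz_cone"
  shows "v + w \<in> interior lorentz_cone"
  using assms norm_triangle_ineq[of "snd v" "snd w"] by (auto simp: interior_lorentz_cone)

lemma interior_lorentz_cone_scaleR:
  "v \<in> interior lorentz_cone \<Longrightarrow> k > 0 \<Longrightarrow> k *\<^sub>R v \<in> interior lorentz_cone"
  by (auto simp: interior_lorentz_cone)

lemma has_derivative_lorentz_omega:
  "(lorentz_omega has_derivative (\<lambda>h. 2 * inner (lorentz_reflect y) h)) (at y)"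
proof -
  have eq: "lorentz_omega = (\<lambda>v. inner (lorentz_reflect v) v)"
    by (simp add: fun_eq_iff lorentz_omega_form inner_eq_lorentz_form)
  note [derivative_intros] = bounded_linear.has_derivative[OF bounded_linear_lorentz_reflect]
  show ?thesis
    unfolding eq
    by (rule derivative_eq_intros refl)+
       (auto simp: fun_eq_iff inner_eq_lorentz_form lorentz_form_commute)
qed

lemma gderiv_lorentz_barrier:
  assumes "y \<in> interior lorentz_cone"
  shows "GDERIV lorentz_barrier y :> (- 2 / lorentz_omega y) *\<^sub>R lorentz_reflect y"
  unfolding gderiv_def lorentz_barrier_def
  by (rule derivative_eq_intros has_derivative_lorentz_omega lorentz_omega_pos[OF assms] refl)+
     (simp add: fun_eq_iff inner_commute field_simps)

text \<open>Quotient rule for the gradient -2 J y / \<omega>(y). J is pulled out by linearity, so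
  that applying it to the scaling equation leaves an equation between p, w and x alone.\<close>

lemma hessian_lorentz_barrier:
  assumes "w \<in> interior lorentz_cone"
  shows "hessian lorentz_barrier w =
    (\<lambda>h. lorentz_reflect ((4 * lorentz_form w h / (lorentz_omega w)\<^sup>2) *\<^sub>R w
                          - (2 / lorentz_omega w) *\<^sub>R h))"
proof (rule hessian_eqI[OF open_interior assms gderiv_lorentz_barrier])
  interpret reflect: bounded_linear lorentz_reflect
    by (rule bounded_linear_lorentz_reflect)
  have nz: "lorentz_omega w \<noteq> 0"
    using lorentz_omega_pos[OF assms] by simp
  show "((\<lambda>y. (- 2 / lorentz_omega y) *\<^sub>R lorentz_reflect y) has_derivative
    (\<lambda>h. lorentz_reflect ((4 * lorentz_form w h / (lorentz_omega w)\<^sup>2) *\<^sub>R w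
                          - (2 / lorentz_omega w) *\<^sub>R h))) (at w)"
    by (rule derivative_eq_intros has_derivative_lorentz_omega reflect.has_derivative nz refl)+
       (simp add: fun_eq_iff inner_eq_lorentz_form reflect.diff reflect.scaleR nz
          power2_eq_square divide_simps)
qed

text \<open>The candidate without \<alpha>, \<beta>, \<tau>: the inner root is the forced value of
  \<omega>(w) / 2, and the leading factor is the forced multiple.\<close>

definition lorentz_scaling_point ::
    "real \<times> (real ^ 'n) \<Rightarrow> real \<times> (real ^ 'n) \<Rightarrow> real \<times> (real ^ 'n)" where
  "lorentz_scaling_point s x =
    (1 / sqrt (inner s x + sqrt (lorentz_omega x * lorentz_omega s))) *\<^sub>R
    (x + sqrt (lorentz_omega x / lorentz_omega s) *\<^sub>R lorentz_reflect s)"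

lemma is_scaling_point_iff:
  assumes x: "x \<in> interior lorentz_cone" and s: "s \<in> interior lorentz_cone"
  shows "is_scaling_point s x w \<longleftrightarrow> w = lorentz_scaling_point s x"
proof -
  define p where "p = lorentz_reflect s"
  define r where "r = sqrt (lorentz_omega x / lorentz_omega s)"
  define d where "d = sqrt (lorentz_omega x * lorentz_omega s)"
  define c where "c = inner s x"
  have p: "p \<in> interior lorentz_cone"
    using s by (simp add: p_def lorentz_reflect_interior)
  have ox: "0 < lorentz_omega x" and os: "0 < lorentz_omega s"
    using x s by (simp_all add: lorentz_omega_pos)
  have c_form: "lorentz_form p x = c"
    by (simp add: c_def p_def inner_eq_lorentz_form)
  have c: "0 < c"
    using lorentz_form_pos[OF p x] c_form by simp
  have r: "0 < r" and d: "0 < d"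
    using ox os by (simp_all add: r_def d_def)
  have sp: "lorentz_scaling_point s x = (1 / sqrt (c + d)) *\<^sub>R (x + r *\<^sub>R p)"
    by (simp add: lorentz_scaling_point_def c_def d_def r_def p_def)
  have reflect_eq: "s = lorentz_reflect v \<longleftrightarrow> p = v" for v
    unfolding p_def by (metis lorentz_reflect_reflect)
  have scaling_eq: "is_scaling_point s x v \<longleftrightarrow> v \<in> interior lorentz_cone \<and>
      p = (4 * lorentz_form v x / (lorentz_omega v)\<^sup>2) *\<^sub>R v - (2 / lorentz_omega v) *\<^sub>R x" for v
    by (auto simp: is_scaling_point_def hessian_lorentz_barrier reflect_eq)
  show ?thesis
  proof
    assume "is_scaling_point s x w"
    define a where "a = lorentz_form w x"
    define \<omega> where "\<omega> = lorentz_omega w"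
    have w: "w \<in> interior lorentz_cone" and eq: "p = (4 * a / \<omega>\<^sup>2) *\<^sub>R w - (2 / \<omega>) *\<^sub>R x"
      using \<open>is_scaling_point s x w\<close> by (simp_all add: scaling_eq a_def \<omega>_def)
    have a: "0 < a" and \<omega>: "0 < \<omega>"
      using w x by (simp_all add: a_def \<omega>_def lorentz_form_pos lorentz_omega_pos)
    have forms: "lorentz_form w x = a" "lorentz_form x w = a" "lorentz_form w w = \<omega>"
      by (simp_all add: a_def \<omega>_def lorentz_form_commute lorentz_omega_form)
    have "lorentz_omega s = lorentz_form p p"
      by (simp add: p_def flip: lorentz_omega_form)
    \<comment> \<open>The square of the w-term contributes 16 a^2 / \<omega>^3 and the mixed terms
      cancel it, so \<open>a\<close> drops out and \<omega> is determined by x and s.\<close>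
    also have "\<dots> = 4 * lorentz_omega x / \<omega>\<^sup>2"
      using \<omega> by (simp add: eq lorentz_form_algebra forms lorentz_omega_form field_simps power2_eq_square)
    finally have os_eq: "lorentz_omega s = 4 * lorentz_omega x / \<omega>\<^sup>2" .
    have r_eq: "r = \<omega> / 2"
      unfolding r_def os_eq using ox \<omega> by (intro real_sqrt_unique) (simp_all add: power2_eq_square)
    have d_eq: "d = 2 * lorentz_omega x / \<omega>"
      unfolding d_def os_eq using ox \<omega> by (intro real_sqrt_unique) (simp_all add: power2_eq_square)
    \<comment> \<open>B p x is 4 a^2 / \<omega>^2 minus exactly \<open>d\<close>; adding
      \<open>d\<close> leaves a square whose positive root fixes the multiple of w.\<close>
    have "c + d = (2 * a / \<omega>)\<^sup>2"
      unfolding d_eq c_form[symmetric]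
      using \<omega> by (simp add: eq lorentz_form_algebra forms lorentz_omega_form power2_eq_square)
    then have "sqrt (c + d) = 2 * a / \<omega>"
      using a \<omega> by simp
    moreover have "x + r *\<^sub>R p = (2 * a / \<omega>) *\<^sub>R w"
      using \<omega> by (simp add: eq r_eq scaleR_diff_right power2_eq_square)
    ultimately show "w = lorentz_scaling_point s x"
      using a \<omega> by (simp add: sp)
  next
    assume "w = lorentz_scaling_point s x"
    then have w: "w = (1 / sqrt (c + d)) *\<^sub>R (x + r *\<^sub>R p)"
      by (simp add: sp)
    have ox_eq: "lorentz_form x x = r * d"
      using ox os by (simp add: r_def d_def real_sqrt_mult real_sqrt_divide flip: lorentz_omega_form)
    have op_eq: "r * lorentz_form p p = d"
      using os by (simp add: r_def d_def p_def real_sqrt_mult real_sqrt_divide real_div_sqrt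
          flip: lorentz_omega_form times_divide_eq_right)
    have "lorentz_form w x = r * (c + d) / sqrt (c + d)"
      by (simp add: w lorentz_form_algebra c_form ox_eq algebra_simps add_divide_distrib)
    then have wx: "lorentz_form w x = r * sqrt (c + d)"
      using c d by (simp add: real_div_sqrt flip: times_divide_eq_right)
    have wp: "lorentz_form w p = sqrt (c + d)"
      using c d op_eq lorentz_form_commute[of x p]
      by (simp add: w lorentz_form_algebra c_form real_div_sqrt flip: add_divide_distrib)
    have ww: "lorentz_omega w = 2 * r"
    proof -
      \<comment> \<open>Only one argument is expanded, so that \<open>wx\<close> and
        \<open>wp\<close> apply: each of the two terms then contributes \<open>r\<close>.\<close>
      have "lorentz_omega w = lorentz_form w ((1 / sqrt (c + d)) *\<^sub>R (x + r *\<^sub>R p))"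
        unfolding lorentz_omega_form by (simp flip: w)
      then show ?thesis
        using c d by (simp add: lorentz_form_algebra wx wp)
    qed
    have "w \<in> interior lorentz_cone"
      unfolding w using x p r c d
      by (intro interior_lorentz_cone_scaleR interior_lorentz_cone_add) simp_all
    moreover have "p = (4 * lorentz_form w x / (lorentz_omega w)\<^sup>2) *\<^sub>R w - (2 / lorentz_omega w) *\<^sub>R x"
    proof -
      \<comment> \<open>By \<open>wx\<close> and \<open>ww\<close>, the coefficients of the scaling
        equation are exactly sqrt (c + d) / r and 1 / r.\<close>
      have "(sqrt (c + d) / r) *\<^sub>R w = (1 / r) *\<^sub>R x + p"
        using c d r by (simp add: w scaleR_add_right)
      then show ?thesis
        using r by (simp add: wx ww power2_eq_square)
    qed
    ultimately show "is_scaling_point s x w"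
      by (simp add: scaling_eq)
  qed
qed

text \<open>This evaluates \<tau> \<alpha>, with c for \<open>inner s x\<close> and d^2 for the
  product of \<omega>(x) and \<omega>(s). The relation \<alpha> (c + d) = c reduces the fraction to
  (c + d) / (2 c), so the radicand is (c + d) / c^2.\<close>

lemma sqrt_scaling_factor:
  fixes c d :: real
  assumes c: "0 < c" and d: "0 < d" and \<alpha>: "\<alpha> = c / (c + d)"
  shows "sqrt (2 / c * ((c\<^sup>2 * (1 - \<alpha>) + \<alpha> * d\<^sup>2) / (c\<^sup>2 * (1 - \<alpha>\<^sup>2) + \<alpha>\<^sup>2 * d\<^sup>2))) * \<alpha>
    = 1 / sqrt (c + d)"
proof -
  have \<alpha>_mult: "\<alpha> * (c + d) = c"
    using c d by (simp add: \<alpha>)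
  have "c\<^sup>2 * (1 - \<alpha>) + \<alpha> * d\<^sup>2 = c\<^sup>2 + (\<alpha> * (c + d)) * (d - c)"
    by (simp add: algebra_simps power2_eq_square)
  also have "\<dots> = c * d"
    unfolding \<alpha>_mult by (simp add: algebra_simps power2_eq_square)
  finally have num: "c\<^sup>2 * (1 - \<alpha>) + \<alpha> * d\<^sup>2 = c * d" .
  have den: "c\<^sup>2 * (1 - \<alpha>\<^sup>2) + \<alpha>\<^sup>2 * d\<^sup>2 = 2 * c\<^sup>2 * d / (c + d)"
  proof -
    have "c + d \<noteq> 0"
      using c d by simp
    then show ?thesis
      \<comment> \<open>After multiplying by c + d, the part \<alpha>^2 (d^2 - c^2) (c + d) equals
        (\<alpha> (c + d))^2 (d - c) = c^2 (d - c), and c^2 (c + d) + c^2 (d - c) = 2 c^2 d.\<close>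
      using \<alpha>_mult by (simp add: eq_divide_eq) algebra
  qed
  have radicand: "2 / c * ((c\<^sup>2 * (1 - \<alpha>) + \<alpha> * d\<^sup>2) / (c\<^sup>2 * (1 - \<alpha>\<^sup>2) + \<alpha>\<^sup>2 * d\<^sup>2))
      = (c + d) / c\<^sup>2"
    unfolding num den using c d by (simp add: field_simps power2_eq_square)
  have "sqrt ((c + d) / c\<^sup>2) * \<alpha> = sqrt (c + d) / (c + d)"
    using c by (simp add: \<alpha> real_sqrt_divide)
  also have "\<dots> = 1 / sqrt (c + d)"
    using c d by (simp add: sqrt_divide_self_eq inverse_eq_divide)
  finally show ?thesis
    unfolding radicand .
qed

theorem mainTheorem4:
  fixes x0 s0 :: real and x1 s1 :: "real ^ 'n"
    and x s :: "real \<times> (real ^ 'n)"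
    and \<omega>x \<omega>s \<alpha> \<beta> f\<alpha> \<tau> :: real
  assumes "x = (x0, x1)" and "s = (s0, s1)"
    and "x \<in> interior lorentz_cone" and "s \<in> interior lorentz_cone"
    and "\<omega>x = lorentz_omega x" and "\<omega>s = lorentz_omega s"
    and "\<alpha> = inner s x / (inner s x + sqrt (\<omega>x * \<omega>s))"
    and "\<beta> = inner s x / \<omega>s * (1 - \<alpha>)"
    and "f\<alpha> = ((inner s x)\<^sup>2 * (1 - \<alpha>) + \<alpha> * \<omega>x * \<omega>s) /
               ((inner s x)\<^sup>2 * (1 - \<alpha>\<^sup>2) + \<alpha>\<^sup>2 * \<omega>x * \<omega>s)"
    and "\<tau> = sqrt (2 / inner s x * f\<alpha>)"
  shows "(\<exists>!w. is_scaling_point s x w) \<and>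
         is_scaling_point s x
           (\<tau> * (\<alpha> * x0 + \<beta> * s0), \<tau> *\<^sub>R (\<alpha> *\<^sub>R x1 - \<beta> *\<^sub>R s1))"
proof -
  define c where "c = inner s x"
  define d where "d = sqrt (\<omega>x * \<omega>s)"
  have c: "0 < c"
    using assms(3,4) by (simp add: c_def inner_eq_lorentz_form lorentz_form_pos lorentz_reflect_interior)
  have pos: "0 < \<omega>x" "0 < \<omega>s"
    using assms(3-6) by (simp_all add: lorentz_omega_pos)
  have d: "0 < d" and d2: "d\<^sup>2 = \<omega>x * \<omega>s"
    using pos by (simp_all add: d_def)
  have \<alpha>: "\<alpha> = c / (c + d)"
    using assms(7) by (simp add: c_def d_def)
  have "\<tau> * \<alpha> = 1 / sqrt (c + d)"
    using sqrt_scaling_factor[OF c d \<alpha>] assms(9,10) by (simp add: d2 c_def mult.assoc)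
  \<comment> \<open>Hence \<alpha> x + \<beta> J s is \<alpha> times the vector in
    \<open>lorentz_scaling_point\<close>, and only the factor \<tau> \<alpha> remains to be
    matched.\<close>
  moreover have "\<beta> = \<alpha> * sqrt (\<omega>x / \<omega>s)"
  proof -
    have "sqrt (\<omega>x / \<omega>s) = d / \<omega>s"
      using pos by (simp add: d_def real_sqrt_divide real_sqrt_mult field_simps)
    moreover have "1 - \<alpha> = d / (c + d)"
      using c d by (simp add: \<alpha> field_simps)
    ultimately show ?thesis
      using assms(8) by (simp add: \<alpha> flip: c_def)
  qed
  ultimately have "\<tau> * \<alpha> = 1 / sqrt (c + d)" "\<tau> * \<beta> = 1 / sqrt (c + d) * sqrt (\<omega>x / \<omega>s)"
    by (metis mult.assoc)+
  then have "(\<tau> * (\<alpha> * x0 + \<beta> * s0), \<tau> *\<^sub>R (\<alpha> *\<^sub>R x1 - \<beta> *\<^sub>R s1)) = lorentz_scaling_point s x"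
    unfolding lorentz_scaling_point_def assms(5,6)[symmetric] c_def[symmetric] d_def[symmetric]
    by (simp add: assms(1,2) lorentz_reflect_def distrib_left scaleR_diff_right scaleR_add_right
        flip: mult.assoc)
  then show ?thesis
    using is_scaling_point_iff[OF assms(3,4)] by auto
qed

end
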